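(* Every finitely generated linear monoid is surjunctive.
   Context: A monoid $M$ is called linear if there exist an integer $n\ge 1$ and a field $K$ such that $M$ is isomorphic to a submonoid of the multiplicative monoid of $n\times n$ matrices with coefficients in $K$ (a submonoid contains the identity element and is closed under multiplication). Let $M$ be a monoid and $A$ a set. The set $A^M$ of all maps $x\colon M\to A$ carries the shift action of $M$ given by $(mx)(m') := x(m'm)$ for $m,m'\in M$, and the prodiscrete uniform structure, for which a base of entourages is given by the sets $W_F := \{(x,y)\in A^M\times A^M : x|_F = y|_F\}$, $F$ running over all finite subsets of $M$. A cellular automaton over $M$ with alphabet $A$ is a map $\tau\colon A^M\to A^M$ that is $M$-equivariant ($\tau(mx)=m\tau(x)$ for all $m\in M$, $x\in A^M$) and uniformly continuous. The monoid $M$ is called surjunctive if, for every finite set $A$, every injective cellular automaton $\tau\colon A^M\to A^M$ is surjective. *)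

theory Defs
  imports "HOL-Algebra.Group" "HOL-Library.FuncSet" "Jordan_Normal_Form.Matrix"
begin

definition finitely_generated_monoid :: "('m, 'z) monoid_scheme \<Rightarrow> bool" where
  "finitely_generated_monoid M \<longleftrightarrow>
     (\<exists>S. finite S \<and> S \<subseteq> carrier M \<and> (\<lambda>H. submonoid H M) hull S = carrier M)"

(* Only the multiplicative monoid part of the matrix ring is used. A homomorphism in the sense of
   hom is only required to preserve the product; being bijective, an isomorphism then preserves
   the identity element as well.
   HOL cannot quantify over types inside a formula, so the field is a type parameter. *)
definition linear_monoid :: "'k::field itself \<Rightarrow> ('m, 'z) monoid_scheme \<Rightarrow> bool" where
  "linear_monoid K M \<longleftrightarrow>
     (\<exists>n\<ge>1. \<exists>H. submonoid H (ring_mat K n ()) \<and> M \<cong> (ring_mat K n ())\<lparr>carrier := H\<rparr>)"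

(* Configurations are extensional functions (undefined outside carrier M), so that equality in
   configs M A is equality of maps M -> A. *)
definition configs :: "('m, 'z) monoid_scheme \<Rightarrow> 'b set \<Rightarrow> ('m \<Rightarrow> 'b) set" where
  "configs M A = carrier M \<rightarrow>\<^sub>E A"

definition shift :: "('m, 'z) monoid_scheme \<Rightarrow> 'm \<Rightarrow> ('m \<Rightarrow> 'b) \<Rightarrow> 'm \<Rightarrow> 'b" where
  "shift M m x = (\<lambda>m'\<in>carrier M. x (m' \<otimes>\<^bsub>M\<^esub> m))"

definition basic_entourage ::
    "('m, 'z) monoid_scheme \<Rightarrow> 'b set \<Rightarrow> 'm set \<Rightarrow> (('m \<Rightarrow> 'b) \<times> ('m \<Rightarrow> 'b)) set" where
  "basic_entourage M A F =
     {(x, y) \<in> configs M A \<times> configs M A. restrict x F = restrict y F}"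

definition prodiscrete_entourages ::
    "('m, 'z) monoid_scheme \<Rightarrow> 'b set \<Rightarrow> (('m \<Rightarrow> 'b) \<times> ('m \<Rightarrow> 'b)) set set" where
  "prodiscrete_entourages M A =
     {E. E \<subseteq> configs M A \<times> configs M A \<and>
         (\<exists>F. finite F \<and> F \<subseteq> carrier M \<and> basic_entourage M A F \<subseteq> E)}"

definition prodiscrete_uniformly_continuous ::
    "('m, 'z) monoid_scheme \<Rightarrow> 'b set \<Rightarrow> (('m \<Rightarrow> 'b) \<Rightarrow> ('m \<Rightarrow> 'b)) \<Rightarrow> bool" where
  "prodiscrete_uniformly_continuous M A \<tau> \<longleftrightarrow>
     (\<forall>E \<in> prodiscrete_entourages M A.
        {(x, y) \<in> configs M A \<times> configs M A. (\<tau> x, \<tau> y) \<in> E} \<in> prodiscrete_entourages M A)"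

definition cellular_automaton ::
    "('m, 'z) monoid_scheme \<Rightarrow> 'b set \<Rightarrow> (('m \<Rightarrow> 'b) \<Rightarrow> ('m \<Rightarrow> 'b)) \<Rightarrow> bool" where
  "cellular_automaton M A \<tau> \<longleftrightarrow>
     \<tau> \<in> configs M A \<rightarrow> configs M A \<and>
     (\<forall>m \<in> carrier M. \<forall>x \<in> configs M A. \<tau> (shift M m x) = shift M m (\<tau> x)) \<and>
     prodiscrete_uniformly_continuous M A \<tau>"

(* The type argument is the type in which the alphabets live; a monoid is surjunctive in the
   usual sense if this holds for every type 'b. *)
definition surjunctive :: "'b itself \<Rightarrow> ('m, 'z) monoid_scheme \<Rightarrow> bool" where
  "surjunctive _ M \<longleftrightarrow>
     (\<forall>A :: 'b set. finite A \<longrightarrow>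
        (\<forall>\<tau>. cellular_automaton M A \<tau> \<and> inj_on \<tau> (configs M A) \<longrightarrow>
             \<tau> ` configs M A = configs M A))"

end

(* A cellular automaton preserves the finite set of configurations that are constant on the classes
   of a left congruence of finite index, so an injective one permutes it. When such congruences
   separate the points of every finite set, these configurations are dense, hence so is the image;
   it is closed by compactness.

   For matrices, the congruences come from reduction modulo an ideal of finite index in a finitely
   generated subring R of the field that contains the entries of the generators. It suffices that
   every nonzero a in R is a unit modulo some proper ideal of finite index. This property passes
   from R to R[x]: if x is transcendental over R and a = f(x), reduce modulo 1 + x a and an ideal of
   R modulo which the leading coefficient of f is a unit; if x is algebraic, a has a nonzero
   multiple in R, and the minimal relation of x replaces 1 + X f. *)
theory Submission
  imports Defs "HOL-Computational_Algebra.Polynomial" "HOL-Analysis.Function_Topology"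
begin

section \<open>Subrings, ideals of finite index, and polynomials with coefficients in a
  subset\<close>

text \<open>Subrings and ideals are subsets of one ambient ring type, so that \<open>'a poly\<close>
  and evaluation by \<open>poly\<close> remain available while the subring grows. Closure under
  subtraction also yields 0, negatives and sums.\<close>

definition unital_subring :: "'a::comm_ring_1 set \<Rightarrow> bool" where
  "unital_subring R \<longleftrightarrow> 1 \<in> R \<and> (\<forall>a\<in>R. \<forall>b\<in>R. a - b \<in> R \<and> a * b \<in> R)"

text \<open>The finite set \<open>S\<close> of representatives replaces the quotient ring; it need
  not contain just one element of each coset.\<close>

definition finite_index_ideal :: "'a::comm_ring_1 set \<Rightarrow> 'a set \<Rightarrow> bool" where
  "finite_index_ideal R I \<longleftrightarrow>
     I \<subseteq> R \<and> 0 \<in> I \<and> (\<forall>a\<in>I. \<forall>b\<in>I. a - b \<in> I) \<and> (\<forall>r\<in>R. \<forall>a\<in>I. r * a \<in> I) \<and>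
     (\<exists>S\<subseteq>R. finite S \<and> (\<forall>r\<in>R. \<exists>s\<in>S. r - s \<in> I))"

text \<open>Stronger than residual finiteness: \<open>a\<close> has to become a unit, not merely
  nonzero. Only so can division by a polynomial with leading coefficient \<open>a\<close> be carried
  out in the quotient, which makes the property pass to \<open>adjoin R x\<close>.\<close>

definition separated_by_finite_quotients :: "'a::comm_ring_1 set \<Rightarrow> bool" where
  "separated_by_finite_quotients R \<longleftrightarrow>
     (\<forall>a\<in>R - {0}. \<exists>I. finite_index_ideal R I \<and> 1 \<notin> I \<and> (\<exists>b\<in>R. a * b - 1 \<in> I))"

text \<open>Applied to a subring \<open>R\<close> this is \<open>R[X]\<close>; applied to an ideal
  \<open>I\<close> of \<open>R\<close> it is the ideal \<open>I[X]\<close> of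
  \<open>R[X]\<close>.\<close>

definition polys_over :: "'a::zero set \<Rightarrow> 'a poly set" where
  "polys_over R = {f. \<forall>i. coeff f i \<in> R}"

definition adjoin :: "'a::comm_ring_1 set \<Rightarrow> 'a \<Rightarrow> 'a set" where
  "adjoin R x = (\<lambda>f. poly f x) ` polys_over R"

lemma polys_overD: "f \<in> polys_over R \<Longrightarrow> coeff f i \<in> R"
  by (simp add: polys_over_def)

lemma unital_subringD:
  assumes "unital_subring R"
  shows "1 \<in> R" "0 \<in> R" "a \<in> R \<Longrightarrow> b \<in> R \<Longrightarrow> a - b \<in> R" "a \<in> R \<Longrightarrow> - a \<in> R"
    "a \<in> R \<Longrightarrow> b \<in> R \<Longrightarrow> a + b \<in> R" "a \<in> R \<Longrightarrow> b \<in> R \<Longrightarrow> a * b \<in> R"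
proof -
  have d: "a - b \<in> R" if "a \<in> R" "b \<in> R" for a b
    using assms that by (auto simp: unital_subring_def)
  show one: "1 \<in> R" using assms by (auto simp: unital_subring_def)
  show zero: "0 \<in> R" using d[OF one one] by simp
  show "a \<in> R \<Longrightarrow> b \<in> R \<Longrightarrow> a - b \<in> R" using d by blast
  show neg: "a \<in> R \<Longrightarrow> - a \<in> R" for a using d[OF zero, of a] by simp
  show "a \<in> R \<Longrightarrow> b \<in> R \<Longrightarrow> a + b \<in> R" using d[OF _ neg, of a b] by simp
  show "a \<in> R \<Longrightarrow> b \<in> R \<Longrightarrow> a * b \<in> R" using assms by (auto simp: unital_subring_def)
qed

lemma unital_subring_sum:
  assumes "unital_subring R" "\<And>i. i \<in> A \<Longrightarrow> f i \<in> R"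
  shows "sum f A \<in> R"
  using assms(2)
  by (induction A rule: infinite_finite_induct) (auto simp: unital_subringD[OF assms(1)])

lemma unital_subring_prod:
  assumes "unital_subring R" "\<And>i. i \<in> A \<Longrightarrow> f i \<in> R"
  shows "prod f A \<in> R"
  using assms(2)
  by (induction A rule: infinite_finite_induct) (auto simp: unital_subringD[OF assms(1)])

lemma unital_subring_power: "unital_subring R \<Longrightarrow> a \<in> R \<Longrightarrow> a ^ n \<in> R"
  by (induction n) (auto simp: unital_subringD)

lemma finite_index_idealD:
  assumes "finite_index_ideal R I"
  shows "a \<in> I \<Longrightarrow> a \<in> R" "0 \<in> I" "a \<in> I \<Longrightarrow> b \<in> I \<Longrightarrow> a - b \<in> I" "a \<in> I \<Longrightarrow> - a \<in> I"
    "a \<in> I \<Longrightarrow> b \<in> I \<Longrightarrow> a + b \<in> I" "r \<in> R \<Longrightarrow> a \<in> I \<Longrightarrow> r * a \<in> I"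
    "r \<in> R \<Longrightarrow> a \<in> I \<Longrightarrow> a * r \<in> I"
proof -
  show "a \<in> I \<Longrightarrow> a \<in> R" using assms by (auto simp: finite_index_ideal_def)
  have d: "a - b \<in> I" if "a \<in> I" "b \<in> I" for a b
    using assms that by (auto simp: finite_index_ideal_def)
  show zero: "0 \<in> I" using assms by (auto simp: finite_index_ideal_def)
  show "a \<in> I \<Longrightarrow> b \<in> I \<Longrightarrow> a - b \<in> I" using d by blast
  show neg: "a \<in> I \<Longrightarrow> - a \<in> I" for a using d[OF zero, of a] by simp
  show "a \<in> I \<Longrightarrow> b \<in> I \<Longrightarrow> a + b \<in> I" using d[OF _ neg, of a b] by simp
  show "r \<in> R \<Longrightarrow> a \<in> I \<Longrightarrow> r * a \<in> I" using assms by (auto simp: finite_index_ideal_def)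
  then show "r \<in> R \<Longrightarrow> a \<in> I \<Longrightarrow> a * r \<in> I" by (simp add: mult.commute)
qed

lemma finite_index_ideal_sum:
  assumes "finite_index_ideal R I" "\<And>i. i \<in> A \<Longrightarrow> f i \<in> I"
  shows "sum f A \<in> I"
  using assms(2)
  by (induction A rule: infinite_finite_induct) (auto simp: finite_index_idealD[OF assms(1)])

lemma polys_over_closed:
  assumes "unital_subring R"
  shows "f \<in> polys_over R \<Longrightarrow> g \<in> polys_over R \<Longrightarrow> f - g \<in> polys_over R"
    "f \<in> polys_over R \<Longrightarrow> g \<in> polys_over R \<Longrightarrow> f + g \<in> polys_over R"
    "f \<in> polys_over R \<Longrightarrow> g \<in> polys_over R \<Longrightarrow> f * g \<in> polys_over R"
    "f \<in> polys_over R \<Longrightarrow> - f \<in> polys_over R"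
    "a \<in> R \<Longrightarrow> monom a n \<in> polys_over R"
    "a \<in> R \<Longrightarrow> f \<in> polys_over R \<Longrightarrow> smult a f \<in> polys_over R"
    "a \<in> R \<Longrightarrow> f \<in> polys_over R \<Longrightarrow> pCons a f \<in> polys_over R"
    "0 \<in> polys_over R" "1 \<in> polys_over R"
  using assms
  by (auto simp: polys_over_def coeff_mult unital_subringD coeff_pCons coeff_1
      intro!: unital_subring_sum split: nat.split)

lemma polys_over_ideal_closed:
  assumes "finite_index_ideal R I"
  shows "f \<in> polys_over I \<Longrightarrow> g \<in> polys_over I \<Longrightarrow> f - g \<in> polys_over I"
    "f \<in> polys_over R \<Longrightarrow> g \<in> polys_over I \<Longrightarrow> f * g \<in> polys_over I"
    "0 \<in> polys_over I" "f \<in> polys_over I \<Longrightarrow> f \<in> polys_over R"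
  using assms
  by (auto simp: polys_over_def coeff_mult finite_index_idealD intro!: finite_index_ideal_sum)

lemma unital_subring_adjoin:
  assumes R: "unital_subring R"
  shows "unital_subring (adjoin R x)" "R \<subseteq> adjoin R x" "x \<in> adjoin R x"
proof -
  note c = polys_over_closed[OF R] unital_subringD[OF R]
  have "poly f x - poly g x \<in> adjoin R x \<and> poly f x * poly g x \<in> adjoin R x"
    if "f \<in> polys_over R" "g \<in> polys_over R" for f g
    unfolding adjoin_def poly_diff[symmetric] poly_mult[symmetric] using that by (blast intro: c)
  moreover have "1 \<in> adjoin R x"
    unfolding adjoin_def by (rule image_eqI[of _ _ 1]) (auto intro: c)
  ultimately show "unital_subring (adjoin R x)"
    unfolding unital_subring_def by (auto simp: adjoin_def)
  show "R \<subseteq> adjoin R x"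
  proof
    fix a assume "a \<in> R"
    then show "a \<in> adjoin R x"
      unfolding adjoin_def by (intro image_eqI[of _ _ "[:a:]"]) (auto intro: c)
  qed
  show "x \<in> adjoin R x"
    unfolding adjoin_def by (intro image_eqI[of _ _ "[:0,1:]"]) (auto intro!: c)
qed

section \<open>Extending an ideal of finite index from \<open>R\<close> to
  \<open>R[x]\<close>\<close>

text \<open>Ordinary long division, except that each cancellation of the top coefficient of
  \<open>f\<close> costs a factor \<open>lead_coeff q\<close>, which need not be invertible in
  \<open>R\<close>. Bounding \<open>r\<close> through its coefficients instead of
  \<open>degree r < degree q\<close> covers constant \<open>q\<close>, where
  \<open>r = 0\<close>.\<close>

lemma pseudo_division_over_subring:
  assumes R: "unital_subring R" and q: "q \<in> polys_over R"
    and f: "f \<in> polys_over R"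
  shows "\<exists>k. \<exists>g\<in>polys_over R. \<exists>r\<in>polys_over R.
    smult (lead_coeff q ^ k) f = q * g + r \<and> (\<forall>i\<ge>degree q. coeff r i = 0)"
proof -
  note c = polys_over_closed[OF R] unital_subringD[OF R]
  define m where "m = degree q"
  define l where "l = lead_coeff q"
  have l: "l \<in> R" unfolding l_def using q by (rule polys_overD)
  have "\<forall>i\<ge>n. coeff f i = 0 \<Longrightarrow> f \<in> polys_over R \<Longrightarrow>
     \<exists>k. \<exists>g\<in>polys_over R. \<exists>r\<in>polys_over R.
      smult (l ^ k) f = q * g + r \<and> (\<forall>i\<ge>m. coeff r i = 0)" for n f
  proof (induction n arbitrary: f)
    case 0
    then have "f = 0" by (auto simp: poly_eq_iff)
    then show ?case
      by (intro exI[of _ 0] bexI[of _ 0]) (auto intro: c)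
  next
    case (Suc n)
    show ?case
    proof (cases "n < m")
      case True
      then show ?thesis using Suc.prems
        by (intro exI[of _ 0] bexI[of _ 0] bexI[of _ f]) (auto intro: c)
    next
      case False
      define t where "t = monom (coeff f n) (n - m)"
      have t: "t \<in> polys_over R" unfolding t_def by (intro c polys_overD Suc.prems)
      define f' where "f' = smult l f - q * t"
      have f': "f' \<in> polys_over R" unfolding f'_def by (intro c l t q Suc.prems)
      have "coeff f' i = 0" if "i \<ge> n" for i
      proof (cases "i = n")
        case True
        have "coeff (q * t) n = coeff f n * l"
          using False unfolding t_def mult.commute[of q] coeff_monom_mult by (simp add: m_def l_def)
        then show ?thesis unfolding f'_def using True by simp
      next
        case ne: False
        have "coeff (q * t) i = 0"
          using False ne that unfolding t_def mult.commute[of q] coeff_monom_mult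
          by (auto simp: m_def coeff_eq_0)
        then show ?thesis unfolding f'_def using Suc.prems ne that by simp
      qed
      then obtain k g r where gr: "g \<in> polys_over R" "r \<in> polys_over R"
        "smult (l ^ k) f' = q * g + r" "\<forall>i\<ge>m. coeff r i = 0"
        using Suc.IH[of f'] f' by blast
      have "smult (l ^ Suc k) f = smult (l ^ k) f' + smult (l ^ k) (q * t)"
        unfolding f'_def by (simp add: smult_diff_right mult.commute)
      also have "\<dots> = q * (g + smult (l ^ k) t) + r"
        using gr by (simp add: algebra_simps)
      finally show ?thesis using gr
        by (intro exI[of _ "Suc k"] bexI[of _ "g + smult (l ^ k) t"] bexI[of _ r])
          (auto intro!: c t unital_subring_power R l)
    qed
  qed
  from this[of "Suc (degree f)" f] f show ?thesis
    by (auto simp: coeff_eq_0 m_def l_def)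
qed

lemma power_unit_mod_ideal:
  assumes R: "unital_subring R" and I: "finite_index_ideal R I"
    and cd: "c \<in> R" "d \<in> R" "c * d - 1 \<in> I"
  shows "c ^ k * d ^ k - 1 \<in> I"
proof (induction k)
  case 0
  then show ?case using finite_index_idealD[OF I] by simp
next
  case (Suc k)
  have "c ^ Suc k * d ^ Suc k - 1 = (c * d) * (c ^ k * d ^ k - 1) + (c * d - 1)"
    by (simp add: algebra_simps)
  moreover have "(c * d) * (c ^ k * d ^ k - 1) + (c * d - 1) \<in> I"
    using unital_subringD(6)[OF R cd(1,2)] finite_index_idealD(5,6)[OF I] Suc cd(3) by blast
  ultimately show ?case by (simp only:)
qed

text \<open>Modulo \<open>I\<close> the leading coefficient of \<open>u\<close> is a unit, so
  degrees add in \<open>u * g\<close>. As \<open>u\<close> has positive degree, a product that is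
  constant modulo \<open>I\<close> forces \<open>g\<close> to vanish modulo
  \<open>I\<close>.\<close>

lemma factor_in_ideal_polys:
  assumes R: "unital_subring R" and I: "finite_index_ideal R I"
    and u: "u \<in> polys_over R" and g: "g \<in> polys_over R"
    and d: "d \<in> R" "lead_coeff u * d - 1 \<in> I"
    and deg: "degree u \<ge> 1" and ug: "\<And>i. i \<ge> 1 \<Longrightarrow> coeff (u * g) i \<in> I"
  shows "g \<in> polys_over I"
proof (rule ccontr)
  assume "g \<notin> polys_over I"
  note cI = finite_index_idealD[OF I]
  define B where "B = {i. coeff g i \<notin> I}"
  have "B \<noteq> {}" using \<open>g \<notin> _\<close> by (auto simp: B_def polys_over_def)
  have "B \<subseteq> {..degree g}" unfolding B_def using cI(2) by (auto intro: le_degree)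
  then have fin: "finite B" by (rule finite_subset) simp
  \<comment> \<open>\<open>j\<close> is the degree of \<open>g\<close> modulo \<open>I\<close>. The
    coefficient of \<open>u * g\<close> at \<open>m + j\<close>, which is at least 1, is congruent
    to \<open>coeff u m * coeff g j\<close>.\<close>
  define j where "j = Max B"
  have jB: "coeff g j \<notin> I" using Max_in[OF fin \<open>B \<noteq> {}\<close>] by (simp add: j_def B_def)
  have above: "coeff g i \<in> I" if "i > j" for i
    using Max_ge[OF fin, of i] that by (auto simp: j_def B_def)
  define m where "m = degree u"
  have "coeff (u * g) (m + j) = (\<Sum>i\<le>m + j. coeff u i * coeff g (m + j - i))"
    by (rule coeff_mult)
  also have "\<dots> = coeff u m * coeff g j +
      (\<Sum>i\<in>{..m + j} - {m}. coeff u i * coeff g (m + j - i))"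
    by (subst sum.remove[of _ m]) auto
  finally have eq: "coeff u m * coeff g j = coeff (u * g) (m + j) -
      (\<Sum>i\<in>{..m + j} - {m}. coeff u i * coeff g (m + j - i))" by simp
  have "(\<Sum>i\<in>{..m + j} - {m}. coeff u i * coeff g (m + j - i)) \<in> I"
  proof (rule finite_index_ideal_sum[OF I])
    fix i assume i: "i \<in> {..m + j} - {m}"
    show "coeff u i * coeff g (m + j - i) \<in> I"
    proof (cases "i < m")
      case True
      then show ?thesis by (intro cI above polys_overD[OF u]) auto
    next
      case False
      then have "coeff u i = 0" using i by (auto simp: m_def coeff_eq_0)
      then show ?thesis using cI(2) by simp
    qed
  qed
  then have *: "coeff u m * coeff g j \<in> I"
    unfolding eq using deg by (intro cI ug) (auto simp: m_def)
  have "coeff g j = d * (coeff u m * coeff g j) - coeff g j * (coeff u m * d - 1)"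
    by (simp add: algebra_simps)
  also have "\<dots> \<in> I"
    using cI(3)[OF cI(6)[OF d(1) *] cI(6)[OF polys_overD[OF g, of j] d(2)]] by (simp add: m_def)
  finally show False using jB by simp
qed

text \<open>\<open>u\<close> behaves modulo \<open>I\<close> like a monic relation for \<open>x\<close>, which need not hold exactly;
  the last hypothesis says that the genuine relations between \<open>x\<close> and \<open>R\<close> are consequences of it
  up to powers of the leading coefficient.\<close>

lemma finite_index_ideal_adjoin:
  fixes x :: "'a::comm_ring_1"
  assumes R: "unital_subring R" and I: "finite_index_ideal R I" and proper: "1 \<notin> I"
    and u: "u \<in> polys_over R" and deg: "degree u \<ge> 1"
    and d: "d \<in> R" "lead_coeff u * d - 1 \<in> I"
    and rel: "\<And>w. w \<in> polys_over R \<Longrightarrow> poly w x = 0 \<Longrightarrow>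
      \<exists>k. \<exists>g\<in>polys_over R. smult (lead_coeff u ^ k) w = u * g"
  shows "\<exists>J. finite_index_ideal (adjoin R x) J \<and> 1 \<notin> J \<and> I \<subseteq> J \<and> poly u x \<in> J"
proof -
  note c = polys_over_closed[OF R] unital_subringD[OF R]
  note cI = finite_index_idealD[OF I]
  note pI = polys_over_ideal_closed[OF I]
  define m where "m = degree u"
  define l where "l = lead_coeff u"
  have l: "l \<in> R" unfolding l_def by (rule polys_overD[OF u])
  have ld: "l ^ k * d ^ k - 1 \<in> I" for k
    using d l by (intro power_unit_mod_ideal[OF R I]) (auto simp: l_def)
  \<comment> \<open>\<open>P\<close> is the ideal of \<open>R[X]\<close> generated by
    \<open>I\<close> and \<open>u\<close>; its image \<open>J\<close> under evaluation at
    \<open>x\<close> is the ideal sought.\<close>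
  define P where "P = {i + u * g | i g. i \<in> polys_over I \<and> g \<in> polys_over R}"
  define J where "J = (\<lambda>f. poly f x) ` P"
  have P_R: "P \<subseteq> polys_over R" unfolding P_def by (auto intro: c u pI(4))
  have P_diff: "f - f' \<in> P" if "f \<in> P" "f' \<in> P" for f f'
  proof -
    from that obtain i g i' g' where "f = i + u * g" "f' = i' + u * g'"
      "i \<in> polys_over I" "g \<in> polys_over R" "i' \<in> polys_over I" "g' \<in> polys_over R"
      unfolding P_def by blast
    then show ?thesis unfolding P_def
      by (intro CollectI exI[of _ "i - i'"] exI[of _ "g - g'"]) (auto intro: c pI simp: algebra_simps)
  qed
  have P_mult: "h * f \<in> P" if "h \<in> polys_over R" "f \<in> P" for h f
  proof -
    from that obtain i g where "f = i + u * g" "i \<in> polys_over I" "g \<in> polys_over R"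
      unfolding P_def by blast
    then show ?thesis unfolding P_def using that
      by (intro CollectI exI[of _ "h * i"] exI[of _ "h * g"]) (auto intro: c pI simp: algebra_simps)
  qed
  have I_P: "polys_over I \<subseteq> P" unfolding P_def using c(8) by force
  have u_P: "u \<in> P" unfolding P_def using c(9) pI(3) by force
  obtain S where S: "S \<subseteq> R" "finite S" "\<And>r. r \<in> R \<Longrightarrow> \<exists>s\<in>S. r - s \<in> I"
    using I unfolding finite_index_ideal_def by blast
  define s where "s r = (SOME s. s \<in> S \<and> r - s \<in> I)" for r
  have s: "s r \<in> S" "r - s r \<in> I" if "r \<in> R" for r
    using someI_ex[of "\<lambda>s. s \<in> S \<and> r - s \<in> I"] S(3)[OF that] unfolding s_def by blast+
  \<comment> \<open>Since \<open>l\<close> is a unit modulo \<open>I\<close>, every polynomial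
    reduces modulo \<open>P\<close> to one with \<open>m\<close> coefficients, and these can be
    taken from \<open>S\<close>. The finitely many values at \<open>x\<close> of such polynomials
    therefore meet every coset of \<open>J\<close>.\<close>
  define T where "T = (\<lambda>xs. poly (Poly xs) x) ` {xs. set xs \<subseteq> S \<and> length xs = m}"
  have "finite T" unfolding T_def using S(2) by (intro finite_imageI finite_lists_length_eq)
  moreover have "T \<subseteq> adjoin R x"
    unfolding T_def adjoin_def using S(1) c(8)
    by (fastforce simp: polys_over_def nth_default_def intro: unital_subringD(2)[OF R])
  moreover have "\<exists>t\<in>T. poly w x - t \<in> J" if w: "w \<in> polys_over R" for w
  proof -
    obtain k g r where gr: "g \<in> polys_over R" "r \<in> polys_over R"
      "smult (l ^ k) w = u * g + r" "\<forall>i\<ge>m. coeff r i = 0"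
      using pseudo_division_over_subring[OF R u w] unfolding l_def m_def by blast
    define r' where "r' = smult (d ^ k) r"
    have r': "r' \<in> polys_over R" unfolding r'_def
      by (intro c unital_subring_power R d gr)
    define v where "v = Poly (map (\<lambda>i. s (coeff r' i)) [0..<m])"
    have v: "poly v x \<in> T" unfolding T_def v_def
      by (intro image_eqI[OF refl]) (auto intro!: s polys_overD[OF r'])
    have rv: "r' - v \<in> polys_over I"
      using s(2)[OF polys_overD[OF r']] gr(4) cI(2)
      by (auto simp: polys_over_def v_def nth_default_def r'_def)
    \<comment> \<open>Pseudo-division describes only \<open>smult (l ^ k) w\<close>. As
      \<open>l ^ k * d ^ k\<close> is 1 modulo \<open>I\<close>, multiplying by \<open>d ^ k\<close>
      recovers \<open>w\<close> up to an element of \<open>polys_over I\<close>.\<close>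
    have "w - v = (r' - v) - smult (l ^ k * d ^ k - 1) w + u * smult (d ^ k) g"
    proof -
      have "smult (l ^ k * d ^ k) w = smult (d ^ k) (u * g + r)"
        unfolding gr(3)[symmetric] by (simp add: mult.commute)
      then show ?thesis
        by (simp add: algebra_simps smult_diff_left r'_def smult_add_right)
    qed
    also have "\<dots> \<in> P" unfolding P_def
    proof (intro CollectI exI conjI, rule refl)
      have "smult (l ^ k * d ^ k - 1) w \<in> polys_over I"
        using cI(7)[OF polys_overD[OF w] ld] by (auto simp: polys_over_def)
      then show "(r' - v) - smult (l ^ k * d ^ k - 1) w \<in> polys_over I"
        by (intro pI rv)
      show "smult (d ^ k) g \<in> polys_over R"
        by (intro c unital_subring_power R d gr)
    qed
    finally show ?thesis using v unfolding J_def by (intro bexI[OF _ v]) (auto simp flip: poly_diff)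
  qed
  ultimately have index: "\<exists>T\<subseteq>adjoin R x. finite T \<and> (\<forall>r\<in>adjoin R x. \<exists>t\<in>T. r - t \<in> J)"
    unfolding adjoin_def by (intro exI[of _ T]) auto
  have "finite_index_ideal (adjoin R x) J"
    unfolding finite_index_ideal_def
  proof (intro conjI index ballI)
    show "J \<subseteq> adjoin R x" unfolding J_def adjoin_def using P_R by blast
    show "0 \<in> J" unfolding J_def using I_P pI(3) by force
    show "a - b \<in> J" if "a \<in> J" "b \<in> J" for a b
      using that P_diff unfolding J_def by (auto simp flip: poly_diff)
    show "a * b \<in> J" if "a \<in> adjoin R x" "b \<in> J" for a b
      using that P_mult unfolding J_def adjoin_def by (auto simp flip: poly_mult)
  qed
  \<comment> \<open>If 1 is the value of \<open>i + u * g\<close> at \<open>x\<close>, then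
    \<open>rel\<close> makes \<open>1 - (i + u * g)\<close> a multiple of \<open>u\<close> up to a
    power of \<open>l\<close>. This gives \<open>g'\<close> with \<open>u * g'\<close> congruent to
    the constant \<open>l ^ k\<close> modulo \<open>I\<close>, so \<open>g'\<close> and then
    \<open>l ^ k\<close> vanish modulo \<open>I\<close>, although \<open>l ^ k\<close> is a unit
    there.\<close>
  moreover have "1 \<notin> J"
  proof
    assume "1 \<in> J"
    then obtain i g where ig: "i \<in> polys_over I" "g \<in> polys_over R" "poly (i + u * g) x = 1"
      unfolding J_def P_def by auto
    have "1 - (i + u * g) \<in> polys_over R" by (intro c u ig pI(4))
    moreover have "poly (1 - (i + u * g)) x = 0" using ig(3) by simp
    ultimately obtain k h where h: "h \<in> polys_over R" "smult (l ^ k) (1 - (i + u * g)) = u * h"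
      using rel unfolding l_def by blast
    have lk: "l ^ k \<in> R" by (intro unital_subring_power R l)
    define g' where "g' = h + smult (l ^ k) g"
    have g': "g' \<in> polys_over R" unfolding g'_def by (intro c h ig lk)
    have eq: "u * g' = [:l ^ k:] - smult (l ^ k) i"
      using h(2) by (simp add: g'_def algebra_simps smult_diff_right smult_add_right one_pCons)
    have "g' \<in> polys_over I"
    proof (rule factor_in_ideal_polys[OF R I u g' d deg])
      fix j :: nat assume "j \<ge> 1"
      then have "coeff (u * g') j = - (l ^ k * coeff i j)"
        unfolding eq by (cases j) auto
      then show "coeff (u * g') j \<in> I"
        by (simp only:) (intro cI lk polys_overD[OF ig(1)])
    qed
    then have "u * g' \<in> polys_over I" by (intro pI u)
    then have "coeff (u * g') 0 \<in> I" by (rule polys_overD)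
    then have "l ^ k - l ^ k * coeff i 0 \<in> I" unfolding eq by simp
    from cI(5)[OF this cI(6)[OF lk polys_overD[OF ig(1), of 0]]] have "l ^ k \<in> I" by simp
    then have "l ^ k * d ^ k - (l ^ k * d ^ k - 1) \<in> I"
      using cI(3)[OF cI(7)[OF unital_subring_power[OF R d(1)]] ld] by blast
    then show False using proper by simp
  qed
  moreover have "I \<subseteq> J"
  proof
    fix a assume "a \<in> I"
    then have "[:a:] \<in> P" using I_P cI(2) by (auto simp: polys_over_def coeff_pCons split: nat.split)
    then show "a \<in> J" unfolding J_def by force
  qed
  moreover have "poly u x \<in> J" unfolding J_def using u_P by blast
  ultimately show ?thesis by blast
qed

text \<open>The remainder of \<open>w\<close> under pseudo-division by \<open>q\<close> is again a
  relation for \<open>x\<close>, of too small a degree to be nonzero. This provides the hypothesis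
  \<open>rel\<close> of \<open>finite_index_ideal_adjoin\<close> for algebraic
  \<open>x\<close>.\<close>

lemma minimal_degree_relation_divides:
  fixes x :: "'a::idom"
  assumes R: "unital_subring R" and q: "q \<in> polys_over R"
    and min: "\<And>p. p \<in> polys_over R \<Longrightarrow> p \<noteq> 0 \<Longrightarrow> poly p x = 0 \<Longrightarrow> degree q \<le> degree p"
    and root: "poly q x = 0" and deg: "degree q \<ge> 1"
    and w: "w \<in> polys_over R" "poly w x = 0"
  shows "\<exists>k. \<exists>g\<in>polys_over R. smult (lead_coeff q ^ k) w = q * g"
proof -
  obtain k g r where gr: "g \<in> polys_over R" "r \<in> polys_over R"
    "smult (lead_coeff q ^ k) w = q * g + r" "\<forall>i\<ge>degree q. coeff r i = 0"
    using pseudo_division_over_subring[OF R q w(1)] by blast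
  have "poly (q * g + r) x = 0" unfolding gr(3)[symmetric] using w(2) by simp
  then have "poly r x = 0" using root by simp
  moreover have "r = 0 \<or> degree r < degree q"
    using gr(4) by (metis leading_coeff_0_iff not_le)
  ultimately have "r = 0" using min[OF gr(2)] by force
  then show ?thesis using gr by auto
qed

text \<open>The norm of an algebraic element would do; taking a multiple \<open>w x\<close> of it with \<open>w\<close> of
  minimal degree avoids resultants.\<close>

lemma algebraic_divides_constant:
  fixes x :: "'a::idom"
  assumes R: "unital_subring R" and q: "q \<in> polys_over R" "q \<noteq> 0"
    and min: "\<And>p. p \<in> polys_over R \<Longrightarrow> p \<noteq> 0 \<Longrightarrow> poly p x = 0 \<Longrightarrow> degree q \<le> degree p"
    and root: "poly q x = 0" and a: "a \<in> adjoin R x" "a \<noteq> 0"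
  shows "\<exists>s\<in>adjoin R x. a * s \<in> R \<and> a * s \<noteq> 0"
proof -
  note c = polys_over_closed[OF R] unital_subringD[OF R]
  note cA = unital_subringD[OF unital_subring_adjoin(1)[OF R]]
  have in_A: "poly f x \<in> adjoin R x" if "f \<in> polys_over R" for f
    using that by (auto simp: adjoin_def)
  define Q where "Q w \<longleftrightarrow> w \<in> polys_over R \<and> poly w x \<noteq> 0 \<and> (\<exists>s\<in>adjoin R x. poly w x = a * s)" for w
  have "\<exists>w. Q w" using a cA(1) unfolding Q_def adjoin_def by fastforce
  then obtain w where w: "Q w" and wmin: "\<And>v. Q v \<Longrightarrow> degree w \<le> degree v"
    using ex_has_least_nat[of Q _ degree] by blast
  obtain s where ws: "w \<in> polys_over R" "poly w x \<noteq> 0" "s \<in> adjoin R x" "poly w x = a * s"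
    using w by (auto simp: Q_def)
  have "degree w = 0"
  proof (rule ccontr)
    assume dw: "degree w \<noteq> 0"
    have "w \<noteq> 0" using ws(2) by auto
    \<comment> \<open>The remainder may be 0, which has degree 0; \<open>dw\<close> makes the strict
      inequality hold then too.\<close>
    have less: "degree r < degree w" if "\<forall>i\<ge>degree w. coeff r i = 0" for r :: "'a poly"
      using that dw by (metis bot_nat_0.not_eq_extremum degree_0 leading_coeff_0_iff not_le)
    \<comment> \<open>Otherwise the remainder of \<open>w\<close> by \<open>q\<close> has smaller
      degree, and its value at \<open>x\<close> is still a nonzero multiple of \<open>a\<close>,
      against the choice of \<open>w\<close>.\<close>
    have wq: "degree w < degree q"
    proof (rule ccontr)
      assume ge: "\<not> degree w < degree q"
      obtain k g r where gr: "g \<in> polys_over R" "r \<in> polys_over R"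
        "smult (lead_coeff q ^ k) w = q * g + r" "\<forall>i\<ge>degree q. coeff r i = 0"
        using pseudo_division_over_subring[OF R q(1) ws(1)] by blast
      have "poly r x = lead_coeff q ^ k * poly w x"
        using arg_cong[OF gr(3), of "\<lambda>p. poly p x"] root by simp
      then have "poly r x = a * (lead_coeff q ^ k * s)" "poly r x \<noteq> 0"
        using ws q(2) by auto
      moreover have "lead_coeff q ^ k * s \<in> adjoin R x"
        using unital_subring_power[OF R polys_overD[OF q(1)]] unital_subring_adjoin(2)[OF R]
        by (intro cA ws(3)) blast
      ultimately have "Q r" unfolding Q_def using gr(2) by blast
      then show False using wmin[of r] less[of r] gr(4) ge by force
    qed
    \<comment> \<open>Now divide the other way round. The value of \<open>r\<close> at
      \<open>x\<close> is a multiple of \<open>a\<close>, hence 0 by the choice of \<open>w\<close>,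
      and then \<open>r = 0\<close> by minimality of \<open>q\<close>. So \<open>g\<close> is a
      nonzero relation for \<open>x\<close>, and its degree is smaller than that of \<open>q\<close>
      by \<open>degree w\<close>.\<close>
    obtain k g r where gr: "g \<in> polys_over R" "r \<in> polys_over R"
      "smult (lead_coeff w ^ k) q = w * g + r" "\<forall>i\<ge>degree w. coeff r i = 0"
      using pseudo_division_over_subring[OF R ws(1) q(1)] by blast
    have dr: "degree r < degree w" using less gr(4) by blast
    have rx: "poly r x = - (poly w x * poly g x)"
      using arg_cong[OF gr(3), of "\<lambda>p. poly p x"] root by (simp add: eq_neg_iff_add_eq_0 add.commute)
    have "poly r x = a * (- (s * poly g x))"
      unfolding rx ws(4) by simp
    moreover have "- (s * poly g x) \<in> adjoin R x"
      by (intro cA ws(3) in_A gr(1))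
    ultimately have "poly r x = 0"
      using wmin[of r] dr gr(2) unfolding Q_def by force
    then have "r = 0" using min[OF gr(2)] dr wq by force
    have "poly g x = 0" using rx \<open>poly r x = 0\<close> ws(2) by simp
    moreover have "g \<noteq> 0" using gr(3) \<open>r = 0\<close> q(2) \<open>w \<noteq> 0\<close> by auto
    ultimately have "degree q \<le> degree g" using min[OF gr(1)] by blast
    moreover have "degree (smult (lead_coeff w ^ k) q) = degree q"
      using \<open>w \<noteq> 0\<close> by simp
    moreover have "degree (smult (lead_coeff w ^ k) q) = degree w + degree g"
      unfolding gr(3) \<open>r = 0\<close> add_0_right by (rule degree_mult_eq[OF \<open>w \<noteq> 0\<close> \<open>g \<noteq> 0\<close>])
    ultimately show False using dw by linarith
  qed
  then obtain e where "w = [:e:]" by (rule degree_eq_zeroE)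
  then have "a * s = coeff w 0" using ws(4) by simp
  then have "a * s \<in> R" using polys_overD[OF ws(1)] by simp
  then show ?thesis using ws(2-4) by auto
qed

lemma separated_by_finite_quotients_adjoin:
  fixes x :: "'a::idom"
  assumes R: "unital_subring R" and sep: "separated_by_finite_quotients R"
  shows "separated_by_finite_quotients (adjoin R x)"
  unfolding separated_by_finite_quotients_def
proof
  note c = polys_over_closed[OF R] unital_subringD[OF R]
  note A = unital_subring_adjoin[OF R, of x]
  note cA = unital_subringD[OF A(1)]
  fix a assume "a \<in> adjoin R x - {0}"
  then have aA: "a \<in> adjoin R x" and a0: "a \<noteq> 0" by auto
  show "\<exists>J. finite_index_ideal (adjoin R x) J \<and> 1 \<notin> J \<and> (\<exists>b\<in>adjoin R x. a * b - 1 \<in> J)"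
  proof (cases "\<exists>q\<in>polys_over R. q \<noteq> 0 \<and> poly q x = 0")
    case True
    then obtain q where q: "q \<in> polys_over R" "q \<noteq> 0" "poly q x = 0"
      and min: "\<And>p. p \<in> polys_over R \<Longrightarrow> p \<noteq> 0 \<Longrightarrow> poly p x = 0 \<Longrightarrow> degree q \<le> degree p"
      using ex_has_least_nat[of "\<lambda>q. q \<in> polys_over R \<and> q \<noteq> 0 \<and> poly q x = 0" _ degree] by blast
    have deg: "degree q \<ge> 1"
    proof (rule ccontr)
      assume "\<not> degree q \<ge> 1"
      then obtain e where "q = [:e:]" using degree_eq_zeroE[of q] by auto
      then show False using q by simp
    qed
    define l where "l = lead_coeff q"
    have l: "l \<in> R" "l \<noteq> 0" using q polys_overD[OF q(1)] by (auto simp: l_def)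
    obtain s where s: "s \<in> adjoin R x" "a * s \<in> R" "a * s \<noteq> 0"
      using algebraic_divides_constant[OF R q(1,2) min q(3) aA a0] by blast
    \<comment> \<open>One ideal must serve twice: inverting the product inverts both
      \<open>l\<close>, as division by \<open>q\<close> requires, and \<open>a * s\<close>, hence
      also \<open>a\<close> modulo \<open>J\<close>.\<close>
    have "l * (a * s) \<in> R - {0}" using l s c by auto
    then obtain I b where I: "finite_index_ideal R I" "1 \<notin> I" "b \<in> R" "l * (a * s) * b - 1 \<in> I"
      using sep unfolding separated_by_finite_quotients_def by blast
    have "\<exists>J. finite_index_ideal (adjoin R x) J \<and> 1 \<notin> J \<and> I \<subseteq> J \<and> poly q x \<in> J"
    proof (rule finite_index_ideal_adjoin[OF R I(1,2) q(1) deg])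
      show "a * s * b \<in> R" by (intro c s I)
      show "lead_coeff q * (a * s * b) - 1 \<in> I" using I(4) by (simp add: l_def mult.assoc)
    qed (rule minimal_degree_relation_divides[OF R q(1) min q(3) deg])
    then obtain J where J: "finite_index_ideal (adjoin R x) J" "1 \<notin> J" "I \<subseteq> J" by blast
    have "a * (s * l * b) - 1 \<in> J" using I(4) J(3) by (auto simp: mult_ac)
    moreover have "s * l * b \<in> adjoin R x" using A(2) l I s by (intro cA) auto
    ultimately show ?thesis using J by blast
  next
    case False
    obtain f where f: "f \<in> polys_over R" "a = poly f x" using aA by (auto simp: adjoin_def)
    then have f0: "f \<noteq> 0" using a0 by auto
    \<comment> \<open>This is \<open>1 + X f\<close>, so \<open>- x\<close> becomes an inverse of
      \<open>a\<close> once the value of \<open>u\<close> at \<open>x\<close> lies in the ideal. It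
      inherits the leading coefficient of \<open>f\<close> and has positive degree even when
      \<open>f\<close> is constant.\<close>
    define u where "u = pCons 1 f"
    have lu: "lead_coeff u = lead_coeff f" using f0 by (simp add: u_def)
    have "lead_coeff f \<in> R - {0}" using f f0 polys_overD by auto
    then obtain I d where I: "finite_index_ideal R I" "1 \<notin> I" "d \<in> R" "lead_coeff f * d - 1 \<in> I"
      using sep unfolding separated_by_finite_quotients_def by blast
    have "\<exists>J. finite_index_ideal (adjoin R x) J \<and> 1 \<notin> J \<and> I \<subseteq> J \<and> poly u x \<in> J"
    proof (rule finite_index_ideal_adjoin[OF R I(1,2) _ _ I(3)])
      show "u \<in> polys_over R" unfolding u_def by (intro c f)
      show "degree u \<ge> 1" using f0 by (simp add: u_def)
      show "lead_coeff u * d - 1 \<in> I" unfolding lu by (rule I(4))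
      show "\<exists>k. \<exists>g\<in>polys_over R. smult (lead_coeff u ^ k) w = u * g"
        if "w \<in> polys_over R" "poly w x = 0" for w
      proof -
        have "w = 0" using False that by blast
        then show ?thesis by (intro exI[of _ 0] bexI[of _ 0]) (auto intro: c)
      qed
    qed
    then obtain J where J: "finite_index_ideal (adjoin R x) J" "1 \<notin> J" "poly u x \<in> J" by blast
    have "a * (- x) - 1 = - poly u x" by (simp add: u_def f(2))
    then have "a * (- x) - 1 \<in> J" using finite_index_idealD(4)[OF J(1,3)] by simp
    then show ?thesis using J A(3) cA(4) by blast
  qed
qed

section \<open>The base case of the integers, and finitely generated subrings\<close>

text \<open>The image of the integers is reduced modulo a prime not dividing \<open>n\<close>. In
  positive characteristic the prime has to be the characteristic, and the ideal is then zero in a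
  finite prime field.\<close>

lemma separated_by_finite_quotients_range_of_int:
  "separated_by_finite_quotients (range (of_int :: int \<Rightarrow> 'a::idom))"
  unfolding separated_by_finite_quotients_def
proof
  fix a :: 'a assume "a \<in> range of_int - {0}"
  then obtain n where n: "a = of_int n" and a0: "a \<noteq> 0" by auto
  obtain p :: nat where p: "prime p" "\<not> int p dvd n" "p = CHAR('a) \<or> CHAR('a) = 0"
  proof (cases "CHAR('a) = 0")
    case True
    obtain p where "prime p" "p > nat \<bar>n\<bar>" using bigger_prime by blast
    moreover have "n \<noteq> 0" using n a0 by auto
    ultimately have "\<not> int p dvd n"
      using zdvd_imp_le[of "int p" "\<bar>n\<bar>"] by (auto simp: nat_less_iff)
    then show ?thesis using that[of p] \<open>prime p\<close> True by auto
  next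
    case False
    then have "prime CHAR('a)" using prime_CHAR_semidom by blast
    moreover have "\<not> int CHAR('a) dvd n"
      using a0 unfolding n by (simp add: of_int_eq_0_iff_char_dvd)
    ultimately show ?thesis using that[of "CHAR('a)"] by auto
  qed
  define I where "I = range (\<lambda>k. of_int (int p * k) :: 'a)"
  have "finite_index_ideal (range (of_int :: int \<Rightarrow> 'a)) I"
    unfolding finite_index_ideal_def
  proof (intro conjI)
    show "I \<subseteq> range of_int" unfolding I_def by blast
    show "0 \<in> I" unfolding I_def by (rule image_eqI[of _ _ 0]) auto
    show "\<forall>a\<in>I. \<forall>b\<in>I. a - b \<in> I" unfolding I_def
      by (auto simp: image_iff simp flip: of_int_mult of_int_diff right_diff_distrib)
    have "of_int j * of_int (int p * k) = (of_int (int p * (j * k)) :: 'a)" for j k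
      by simp
    then show "\<forall>r\<in>range of_int. \<forall>a\<in>I. r * a \<in> I" unfolding I_def by blast
    have "of_int r - of_int (r mod int p) \<in> I" for r
    proof -
      have "(of_int r - of_int (r mod int p) :: 'a) = of_int (int p * (r div int p))"
        by (simp only: of_int_diff[symmetric] minus_mod_eq_mult_div)
      then show ?thesis unfolding I_def by blast
    qed
    moreover have "r mod int p \<in> {0..<int p}" for r
      using p(1) prime_gt_0_nat by auto
    ultimately show "\<exists>S\<subseteq>range of_int. finite S \<and> (\<forall>r\<in>range of_int. \<exists>s\<in>S. (r :: 'a) - s \<in> I)"
      by (intro exI[of _ "of_int ` {0..<int p}"]) fast
  qed
  moreover have "1 \<notin> I"
  proof
    assume "1 \<in> I"
    then obtain k where "(1 :: 'a) = of_int (int p * k)" by (auto simp: I_def)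
    then have "(of_int (int p * k - 1) :: 'a) = 0" by (simp only: of_int_diff of_int_1) simp
    then have "int CHAR('a) dvd int p * k - 1"
      by (rule of_int_eq_0_iff_char_dvd[THEN iffD1])
    \<comment> \<open>In characteristic 0 the divisibility by \<open>CHAR('a)\<close> says that
      \<open>int p * k - 1\<close> is 0, which \<open>int p\<close> divides as well.\<close>
    then have "int p dvd int p * k - 1" using p(3) by auto
    then have "int p dvd 1" by (metis dvd_diffD1 dvd_triv_left dvd_diff_right_iff)
    then show False using p(1) by auto
  qed
  moreover have "\<exists>b\<in>range of_int. a * b - 1 \<in> I"
  proof -
    have "coprime (int p) n" using p(1,2) by (simp add: prime_imp_coprime)
    then obtain u v where "n * u + int p * v = 1"
      using bezout_int[of n "int p"] by (auto simp: coprime_iff_gcd_eq_1 gcd.commute mult.commute)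
    then have "n * u - 1 = int p * (- v)" by simp
    then have "a * of_int u - 1 = of_int (int p * (- v))"
      unfolding n by (metis of_int_1 of_int_diff of_int_mult)
    then show ?thesis unfolding I_def by blast
  qed
  ultimately show "\<exists>I. finite_index_ideal (range of_int) I \<and> 1 \<notin> I \<and> (\<exists>b\<in>range of_int. a * b - 1 \<in> I)"
    by blast
qed

text \<open>The elements of \<open>E\<close> are adjoined one at a time to the image of the
  integers.\<close>

lemma finite_set_in_separated_subring:
  fixes E :: "'a::idom set"
  assumes "finite E"
  shows "\<exists>R. unital_subring R \<and> separated_by_finite_quotients R \<and> E \<subseteq> R"
  using assms
proof (induction E)
  case empty
  have "unital_subring (range (of_int :: int \<Rightarrow> 'a))"
    unfolding unital_subring_def
    by (auto simp flip: of_int_diff of_int_mult) (metis of_int_1 rangeI)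
  then show ?case using separated_by_finite_quotients_range_of_int by blast
next
  case (insert x E)
  then obtain R where "unital_subring R" "separated_by_finite_quotients R" "E \<subseteq> R" by blast
  then show ?case
    using unital_subring_adjoin separated_by_finite_quotients_adjoin
    by (intro exI[of _ "adjoin R x"]) blast
qed

section \<open>Finite left congruences on monoids of matrices\<close>

lemma coset_eq_iff:
  assumes R: "unital_subring R" and I: "finite_index_ideal R I" and x: "x \<in> R" and y: "y \<in> R"
  shows "{r \<in> R. r - x \<in> I} = {r \<in> R. r - y \<in> I} \<longleftrightarrow> x - y \<in> I"
proof
  assume "{r \<in> R. r - x \<in> I} = {r \<in> R. r - y \<in> I}"
  moreover have "x \<in> {r \<in> R. r - x \<in> I}" using x finite_index_idealD(2)[OF I] by simp
  ultimately show "x - y \<in> I" by blast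
next
  assume xy: "x - y \<in> I"
  have "r - x \<in> I \<longleftrightarrow> r - y \<in> I" for r
    using finite_index_idealD(5)[OF I _ xy, of "r - x"] finite_index_idealD(3)[OF I _ xy, of "r - y"]
    by auto
  then show "{r \<in> R. r - x \<in> I} = {r \<in> R. r - y \<in> I}" by blast
qed

text \<open>\<open>c m\<close> is the matrix \<open>h m\<close> reduced modulo an ideal of finite
  index. Entries of a product are linear in the right factor with coefficients in \<open>R\<close>,
  so congruence survives left multiplication.\<close>

lemma finite_left_congruence_matrices:
  fixes M :: "('m, 'z) monoid_scheme" and h :: "'m \<Rightarrow> 'k::idom mat"
  assumes M: "monoid M"
    and h: "\<And>m. m \<in> carrier M \<Longrightarrow> h m \<in> carrier_mat n n"
      "\<And>m m'. m \<in> carrier M \<Longrightarrow> m' \<in> carrier M \<Longrightarrow> h (m \<otimes>\<^bsub>M\<^esub> m') = h m * h m'"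
      "inj_on h (carrier M)"
    and R: "unital_subring R" "separated_by_finite_quotients R"
    and hR: "\<And>m i j. m \<in> carrier M \<Longrightarrow> i < n \<Longrightarrow> j < n \<Longrightarrow> h m $$ (i, j) \<in> R"
    and F: "finite F" "F \<subseteq> carrier M"
  shows "\<exists>c :: 'm \<Rightarrow> nat \<times> nat \<Rightarrow> 'k set. finite (c ` carrier M) \<and> inj_on c F \<and>
    (\<forall>m\<in>carrier M. \<forall>m1\<in>carrier M. \<forall>m2\<in>carrier M.
      c m1 = c m2 \<longrightarrow> c (m \<otimes>\<^bsub>M\<^esub> m1) = c (m \<otimes>\<^bsub>M\<^esub> m2))"
proof -
  define D where "D = {(m, m') \<in> F \<times> F. m \<noteq> m'}"
  have "finite D" unfolding D_def using F(1) by (auto intro: finite_subset[of _ "F \<times> F"])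
  have "\<exists>p\<in>{..<n} \<times> {..<n}. h m $$ p \<noteq> h m' $$ p" if "(m, m') \<in> D" for m m'
  proof (rule ccontr)
    assume neg: "\<not> ?thesis"
    have mm: "m \<in> carrier M" "m' \<in> carrier M" "m \<noteq> m'" using that F(2) by (auto simp: D_def)
    have "h m = h m'" using h(1)[OF mm(1)] h(1)[OF mm(2)] neg by (intro eq_matI) auto
    then show False using h(3) mm by (auto dest: inj_onD)
  qed
  then have "\<forall>e\<in>D. \<exists>p\<in>{..<n} \<times> {..<n}. h (fst e) $$ p \<noteq> h (snd e) $$ p" by auto
  then obtain p where p: "\<And>e. e \<in> D \<Longrightarrow> p e \<in> {..<n} \<times> {..<n} \<and> h (fst e) $$ p e \<noteq> h (snd e) $$ p e"
    using bchoice[of D "\<lambda>e q. q \<in> {..<n} \<times> {..<n} \<and> h (fst e) $$ q \<noteq> h (snd e) $$ q"] by blast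
  have hR': "h m $$ q \<in> R" if "m \<in> carrier M" "q \<in> {..<n} \<times> {..<n}" for m q
    using hR that by auto
  define \<delta> where "\<delta> e = h (fst e) $$ p e - h (snd e) $$ p e" for e
  have \<delta>R: "\<delta> e \<in> R" if "e \<in> D" for e
    unfolding \<delta>_def using p[OF that] that F(2)
    by (intro unital_subringD(3)[OF R(1)] hR') (auto simp: D_def)
  \<comment> \<open>One element handles all pairs in \<open>F\<close>: each pair contributes an
    entry where its matrices differ, and an ideal modulo which the product is a unit contains no
    factor.\<close>
  have "prod \<delta> D \<noteq> 0" using \<open>finite D\<close> p by (auto simp: \<delta>_def)
  moreover have "prod \<delta> D \<in> R" using \<delta>R by (intro unital_subring_prod R)
  ultimately obtain I b where I: "finite_index_ideal R I" "1 \<notin> I" and b: "b \<in> R" "prod \<delta> D * b - 1 \<in> I"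
    using R(2) unfolding separated_by_finite_quotients_def by blast
  note cI = finite_index_idealD[OF I(1)]
  \<comment> \<open>Residue classes appear as actual cosets, so that congruence becomes equality of
    values of \<open>c\<close>.\<close>
  define c where "c m = (\<lambda>q\<in>{..<n} \<times> {..<n}. {r \<in> R. r - h m $$ q \<in> I})" for m
  have c_eq: "c m = c m' \<longleftrightarrow> (\<forall>q\<in>{..<n} \<times> {..<n}. h m $$ q - h m' $$ q \<in> I)"
    if "m \<in> carrier M" "m' \<in> carrier M" for m m'
  proof -
    have "c m = c m' \<longleftrightarrow>
        (\<forall>q\<in>{..<n} \<times> {..<n}. {r \<in> R. r - h m $$ q \<in> I} = {r \<in> R. r - h m' $$ q \<in> I})"
      unfolding c_def by (simp add: restrict_def fun_eq_iff) blast
    also have "\<dots> \<longleftrightarrow> (\<forall>q\<in>{..<n} \<times> {..<n}. h m $$ q - h m' $$ q \<in> I)"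
      using coset_eq_iff[OF R(1) I(1)] hR' that by (intro ball_cong refl) blast
    finally show ?thesis .
  qed
  have "finite (c ` carrier M)"
  proof -
    obtain S where S: "S \<subseteq> R" "finite S" "\<And>r. r \<in> R \<Longrightarrow> \<exists>s\<in>S. r - s \<in> I"
      using I(1) unfolding finite_index_ideal_def by blast
    have "{t \<in> R. t - r \<in> I} \<in> (\<lambda>s. {t \<in> R. t - s \<in> I}) ` S" if r: "r \<in> R" for r
    proof -
      obtain s where "s \<in> S" "r - s \<in> I" using S(3)[OF r] by blast
      then show ?thesis using coset_eq_iff[OF R(1) I(1) r, of s] S(1) by blast
    qed
    then have "c ` carrier M \<subseteq> ({..<n} \<times> {..<n}) \<rightarrow>\<^sub>E ((\<lambda>s. {t \<in> R. t - s \<in> I}) ` S)"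
      unfolding c_def using hR' by (intro image_subsetI restrict_PiE_iff[THEN iffD2]) blast
    then show ?thesis
      by (rule finite_subset) (intro finite_PiE finite_cartesian_product finite_lessThan finite_imageI S)
  qed
  moreover have "inj_on c F"
  proof (rule inj_onI, rule ccontr)
    fix m m' assume mm: "m \<in> F" "m' \<in> F" "c m = c m'" "m \<noteq> m'"
    then have e: "(m, m') \<in> D" by (simp add: D_def)
    have "h m $$ p (m, m') - h m' $$ p (m, m') \<in> I"
      using c_eq[OF subsetD[OF F(2) mm(1)] subsetD[OF F(2) mm(2)], THEN iffD1, OF mm(3)]
      by (rule bspec) (rule conjunct1[OF p[OF e]])
    then have "\<delta> (m, m') \<in> I" by (simp add: \<delta>_def)
    moreover have "prod \<delta> (D - {(m, m')}) \<in> R" using \<delta>R by (intro unital_subring_prod R) auto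
    ultimately have "prod \<delta> D \<in> I"
      unfolding prod.remove[OF \<open>finite D\<close> e] by (intro cI(7))
    then have "prod \<delta> D * b - (prod \<delta> D * b - 1) \<in> I" by (rule cI(3)[OF cI(7)[OF b(1)] b(2)])
    then show False using I(2) by simp
  qed
  moreover have "c (m \<otimes>\<^bsub>M\<^esub> m1) = c (m \<otimes>\<^bsub>M\<^esub> m2)"
    if m: "m \<in> carrier M" "m1 \<in> carrier M" "m2 \<in> carrier M" and eq: "c m1 = c m2" for m m1 m2
  proof -
    have "h (m \<otimes>\<^bsub>M\<^esub> m1) $$ (i, j) - h (m \<otimes>\<^bsub>M\<^esub> m2) $$ (i, j) \<in> I" if ij: "i < n" "j < n" for i j
    proof -
      have entry: "h (m \<otimes>\<^bsub>M\<^esub> m') $$ (i, j) = (\<Sum>k<n. h m $$ (i, k) * h m' $$ (k, j))"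
        if "m' \<in> carrier M" for m'
        using h(1)[OF m(1)] h(1)[OF that] ij
        by (simp add: h(2)[OF m(1) that] scalar_prod_def lessThan_atLeast0)
      have "h (m \<otimes>\<^bsub>M\<^esub> m1) $$ (i, j) - h (m \<otimes>\<^bsub>M\<^esub> m2) $$ (i, j) =
          (\<Sum>k<n. h m $$ (i, k) * (h m1 $$ (k, j) - h m2 $$ (k, j)))"
        by (simp add: entry m sum_subtractf right_diff_distrib)
      also have "\<dots> \<in> I"
        using eq c_eq[OF m(2,3)] m(1) ij
        by (intro finite_index_ideal_sum[OF I(1)] cI(6) hR) auto
      finally show ?thesis .
    qed
    then show ?thesis using c_eq monoid.m_closed[OF M] m by auto
  qed
  ultimately show ?thesis by blast
qed

section \<open>Cellular automata: locality, closed image, and periodic configurations\<close>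

text \<open>This is uniform continuity tested on the entourage of \<open>{m}\<close>;
  \<open>S\<close> is a finite memory set for the value at \<open>m\<close>.\<close>

lemma cellular_automaton_local:
  assumes "cellular_automaton M A \<tau>" and m: "m \<in> carrier M"
  shows "\<exists>S. finite S \<and> S \<subseteq> carrier M \<and>
    (\<forall>x\<in>configs M A. \<forall>y\<in>configs M A. (\<forall>s\<in>S. x s = y s) \<longrightarrow> \<tau> x m = \<tau> y m)"
proof -
  have "basic_entourage M A {m} \<in> prodiscrete_entourages M A"
    unfolding prodiscrete_entourages_def
    using m by (intro CollectI conjI exI[of _ "{m}"]) (auto simp: basic_entourage_def)
  then obtain S where S: "finite S" "S \<subseteq> carrier M"
    "basic_entourage M A S \<subseteq> {(x, y) \<in> configs M A \<times> configs M A. (\<tau> x, \<tau> y) \<in> basic_entourage M A {m}}"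
    using assms unfolding cellular_automaton_def prodiscrete_uniformly_continuous_def
      prodiscrete_entourages_def[of M A] by blast
  have "\<tau> x m = \<tau> y m" if "x \<in> configs M A" "y \<in> configs M A" "\<forall>s\<in>S. x s = y s" for x y
  proof -
    have "(x, y) \<in> basic_entourage M A S"
      using that by (auto simp: basic_entourage_def intro: restrict_ext)
    then have "(\<tau> x, \<tau> y) \<in> basic_entourage M A {m}" using S(3) by blast
    then have "restrict (\<tau> x) {m} = restrict (\<tau> y) {m}" by (simp add: basic_entourage_def)
    then have "restrict (\<tau> x) {m} m = restrict (\<tau> y) {m} m" by (rule fun_cong)
    then show ?thesis by simp
  qed
  then show ?thesis using S by blast
qed

text \<open>By locality, the configurations whose image agrees with \<open>z\<close> at
  \<open>m\<close> form a closed set \<open>K m\<close>. By \<open>approx\<close> any finitely many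
  of these sets have a common point, so by compactness of the product all do, and such a point is a
  preimage of \<open>z\<close>.\<close>

lemma closed_image_of_cellular_automaton:
  assumes A: "finite A" and ca: "cellular_automaton M A \<tau>" and z: "z \<in> configs M A"
    and approx: "\<And>F. finite F \<Longrightarrow> F \<subseteq> carrier M \<Longrightarrow> \<exists>x\<in>configs M A. \<forall>m\<in>F. \<tau> x m = z m"
  shows "z \<in> \<tau> ` configs M A"
proof -
  define T where "T = product_topology (\<lambda>_. discrete_topology A) (carrier M)"
  have top: "topspace T = configs M A" by (simp add: T_def configs_def)
  have compact: "compact_space T" unfolding T_def compact_space_product_topology
    using A by (simp add: compact_space_def compactin_discrete_topology)
  define K where "K m = {x \<in> configs M A. \<tau> x m = z m}" for m
  have "closedin T (K m)" if m: "m \<in> carrier M" for m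
  proof -
    obtain S where S: "finite S" "S \<subseteq> carrier M"
      "\<And>x y. x \<in> configs M A \<Longrightarrow> y \<in> configs M A \<Longrightarrow> \<forall>s\<in>S. x s = y s \<Longrightarrow> \<tau> x m = \<tau> y m"
      using cellular_automaton_local[OF ca m] by blast
    have "\<exists>U. openin T U \<and> x \<in> U \<and> U \<subseteq> configs M A - K m" if x: "x \<in> configs M A - K m" for x
    proof (intro exI conjI)
      \<comment> \<open>The cylinder of configurations that agree with \<open>x\<close> on the
        memory set \<open>S\<close>.\<close>
      define U where "U = (\<Pi>\<^sub>E s\<in>carrier M. if s \<in> S then {x s} else A)"
      have xA: "x s \<in> A" if "s \<in> carrier M" for s using x that by (auto simp: configs_def)
      have "finite {s \<in> carrier M. (if s \<in> S then {x s} else A) \<noteq> A}"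
        by (rule finite_subset[OF _ S(1)]) auto
      then show "openin T U" unfolding T_def U_def openin_PiE_gen using xA by auto
      show "x \<in> U" using x xA by (auto simp: U_def configs_def PiE_iff)
      show "U \<subseteq> configs M A - K m"
      proof
        fix y assume y: "y \<in> U"
        have "y s \<in> A" if "s \<in> carrier M" for s
          using PiE_mem[OF y[unfolded U_def] that] xA[OF that] by (auto split: if_splits)
        then have yc: "y \<in> configs M A" using y by (auto simp: configs_def U_def PiE_iff)
        have "\<forall>s\<in>S. y s = x s"
          using y S(2) by (fastforce simp: U_def PiE_iff)
        then have "\<tau> y m = \<tau> x m" using S(3)[of y x] yc x by blast
        then show "y \<in> configs M A - K m" using x yc by (auto simp: K_def)
      qed
    qed
    then have "openin T (configs M A - K m)" by (subst openin_subopen) blast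
    then show ?thesis unfolding closedin_def top by (auto simp: K_def)
  qed
  then have cl: "\<forall>C\<in>K ` carrier M. closedin T C" by blast
  have "\<Inter> \<F> \<noteq> {}" if fam: "finite \<F>" "\<F> \<subseteq> K ` carrier M" for \<F>
  proof -
    obtain F where F: "finite F" "F \<subseteq> carrier M" "\<F> = K ` F"
      using finite_subset_image[OF fam] by (elim exE conjE)
    then show ?thesis using approx[of F] by (auto simp: K_def)
  qed
  then have "\<forall>\<F>. finite \<F> \<and> \<F> \<subseteq> K ` carrier M \<longrightarrow> \<Inter> \<F> \<noteq> {}" by simp
  then have "\<Inter> (K ` carrier M) \<noteq> {}"
    by (rule compact[unfolded compact_space_fip, THEN spec, THEN mp, OF conjI, OF cl])
  then obtain x where x: "\<And>m. m \<in> carrier M \<Longrightarrow> x \<in> K m" by blast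
  show ?thesis
  \<comment> \<open>An intersection over no index is the whole type, so \<open>x\<close> is known to
    be a configuration only if \<open>carrier M\<close> has an element.\<close>
  proof (cases "carrier M = {}")
    case True
    then have "configs M A = {z}" using z by (auto simp: configs_def)
    then show ?thesis using ca by (auto simp: cellular_automaton_def)
  next
    case False
    then have xc: "x \<in> configs M A" using x by (auto simp: K_def)
    then have "\<tau> x \<in> configs M A" using ca by (auto simp: cellular_automaton_def)
    then have "\<tau> x = z" using z x unfolding configs_def by (intro PiE_ext) (auto simp: K_def)
    then show ?thesis using xc by blast
  qed
qed

text \<open>If \<open>x\<close> is constant on the classes of a left congruence, then
  \<open>shift M m x\<close> depends only on the class of \<open>m\<close>. By equivariance
  \<open>\<tau> x m\<close> is the value of \<open>\<tau> (shift M m x)\<close> at the identity, so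
  \<open>\<tau> x\<close> is constant on the classes too.\<close>

lemma surjunctive_if_finite_left_congruences:
  fixes M :: "('m, 'z) monoid_scheme"
  assumes M: "monoid M"
    and sep: "\<And>F. finite F \<Longrightarrow> F \<subseteq> carrier M \<Longrightarrow>
      \<exists>c :: 'm \<Rightarrow> 'q. finite (c ` carrier M) \<and> inj_on c F \<and>
        (\<forall>m\<in>carrier M. \<forall>m1\<in>carrier M. \<forall>m2\<in>carrier M.
          c m1 = c m2 \<longrightarrow> c (m \<otimes>\<^bsub>M\<^esub> m1) = c (m \<otimes>\<^bsub>M\<^esub> m2))"
  shows "surjunctive TYPE('b) M"
  unfolding surjunctive_def
proof (intro allI impI)
  interpret monoid M by (rule M)
  fix A :: "'b set" and \<tau>
  assume A: "finite A" and "cellular_automaton M A \<tau> \<and> inj_on \<tau> (configs M A)"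
  then have ca: "cellular_automaton M A \<tau>" and inj: "inj_on \<tau> (configs M A)" by auto
  have \<tau>: "\<tau> x \<in> configs M A" if "x \<in> configs M A" for x
    using ca that by (auto simp: cellular_automaton_def)
  have at_one: "\<tau> x m = \<tau> (shift M m x) \<one>\<^bsub>M\<^esub>" if "x \<in> configs M A" "m \<in> carrier M" for x m
    using ca that by (simp add: cellular_automaton_def shift_def)
  have "\<exists>x\<in>configs M A. \<forall>m\<in>F. \<tau> x m = z m"
    if z: "z \<in> configs M A" and F: "finite F" "F \<subseteq> carrier M" for z F
  proof -
    obtain c :: "'m \<Rightarrow> 'q" where c: "finite (c ` carrier M)" "inj_on c F"
      "\<And>m m1 m2. m \<in> carrier M \<Longrightarrow> m1 \<in> carrier M \<Longrightarrow> m2 \<in> carrier M \<Longrightarrow> c m1 = c m2 \<Longrightarrow>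
        c (m \<otimes>\<^bsub>M\<^esub> m1) = c (m \<otimes>\<^bsub>M\<^esub> m2)"
      using sep[OF F] by blast
    define P where "P = {x \<in> configs M A. \<forall>m1\<in>carrier M. \<forall>m2\<in>carrier M. c m1 = c m2 \<longrightarrow> x m1 = x m2}"
    \<comment> \<open>Members of \<open>P\<close> factor through \<open>c\<close>, and only finitely
      many maps go from the finite set of classes to \<open>A\<close>.\<close>
    have "P \<subseteq> (\<lambda>y. \<lambda>m\<in>carrier M. y (c m)) ` (c ` carrier M \<rightarrow>\<^sub>E A)"
    proof
      fix x assume x: "x \<in> P"
      define y where "y = (\<lambda>q\<in>c ` carrier M. x (inv_into (carrier M) c q))"
      have "x m = y (c m)" if m: "m \<in> carrier M" for m
      proof -
        have "c m = c (inv_into (carrier M) c (c m))"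
          using f_inv_into_f[OF imageI[OF m, of c]] by simp
        then have "x m = x (inv_into (carrier M) c (c m))"
          using x m inv_into_into[OF imageI[OF m, of c]] unfolding P_def by blast
        then show ?thesis using m by (simp add: y_def)
      qed
      then have "x = (\<lambda>m\<in>carrier M. y (c m))"
        using x by (auto simp: P_def configs_def PiE_def extensional_def fun_eq_iff)
      moreover have "y \<in> c ` carrier M \<rightarrow>\<^sub>E A"
        using x unfolding y_def P_def configs_def by (auto intro!: inv_into_into)
      ultimately show "x \<in> (\<lambda>y. \<lambda>m\<in>carrier M. y (c m)) ` (c ` carrier M \<rightarrow>\<^sub>E A)" by blast
    qed
    then have "finite P"
      by (rule finite_subset) (intro finite_imageI finite_PiE c A)
    moreover have "\<tau> ` P \<subseteq> P"
    proof (rule image_subsetI)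
      fix x assume x: "x \<in> P"
      then have xc: "x \<in> configs M A" by (simp add: P_def)
      have "\<tau> x m1 = \<tau> x m2" if m: "m1 \<in> carrier M" "m2 \<in> carrier M" "c m1 = c m2" for m1 m2
      proof -
        have "shift M m1 x = shift M m2 x"
          unfolding shift_def
        proof (rule restrict_ext)
          fix m' assume m': "m' \<in> carrier M"
          show "x (m' \<otimes>\<^bsub>M\<^esub> m1) = x (m' \<otimes>\<^bsub>M\<^esub> m2)"
            using x c(3)[OF m' m] m_closed[OF m' m(1)] m_closed[OF m' m(2)] unfolding P_def by blast
        qed
        then show ?thesis using at_one[OF xc] m by simp
      qed
      then show "\<tau> x \<in> P" using \<tau>[OF xc] unfolding P_def by blast
    qed
    moreover have "inj_on \<tau> P" using inj by (rule inj_on_subset) (auto simp: P_def)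
    ultimately have surj: "\<tau> ` P = P" by (rule endo_inj_surj)
    \<comment> \<open>\<open>z'\<close> extends \<open>z\<close> from \<open>F\<close> to a member
      of \<open>P\<close>, which is possible because \<open>c\<close> is injective on
      \<open>F\<close>. Classes that miss \<open>F\<close> get the value of \<open>z\<close> at the
      identity, an arbitrary default in \<open>A\<close>.\<close>
    define z' where "z' = (\<lambda>m\<in>carrier M. z (if c m \<in> c ` F then the_inv_into F c (c m) else \<one>\<^bsub>M\<^esub>))"
    have "z' \<in> configs M A"
      using z F(2) the_inv_into_into[OF c(2)] unfolding z'_def configs_def
      by (fastforce simp: PiE_iff)
    moreover have "z' m1 = z' m2" if "m1 \<in> carrier M" "m2 \<in> carrier M" "c m1 = c m2" for m1 m2
      unfolding z'_def using that by simp
    ultimately have "z' \<in> P" unfolding P_def by blast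
    then have "z' \<in> \<tau> ` P" unfolding surj .
    then obtain x where x: "x \<in> P" "\<tau> x = z'" by (elim imageE) simp
    have "z' m = z m" if "m \<in> F" for m
      using that F(2) the_inv_into_f_f[OF c(2)] by (auto simp: z'_def)
    then have "\<forall>m\<in>F. \<tau> x m = z m" unfolding x(2) by blast
    then show ?thesis using x(1) unfolding P_def by blast
  qed
  then have "configs M A \<subseteq> \<tau> ` configs M A"
    by (intro subsetI closed_image_of_cellular_automaton[OF A ca])
  moreover have "\<tau> ` configs M A \<subseteq> configs M A" by (intro image_subsetI \<tau>)
  ultimately show "\<tau> ` configs M A = configs M A" by (rule subset_antisym[rotated])
qed

section \<open>From a finitely generated linear monoid to matrices over one subring\<close>

theorem corollary5p20:
  fixes M :: "('m, 'z) monoid_scheme"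
  assumes "monoid M"
    and "finitely_generated_monoid M"
    and "linear_monoid TYPE('k::field) M"
  shows "surjunctive TYPE('b) M"
proof -
  interpret monoid M by (rule assms(1))
  obtain S where S: "finite S" "S \<subseteq> carrier M" "(\<lambda>H. submonoid H M) hull S = carrier M"
    using assms(2) unfolding finitely_generated_monoid_def by blast
  obtain n H h where H: "submonoid H (ring_mat TYPE('k) n ())"
    and h: "h \<in> iso M ((ring_mat TYPE('k) n ())\<lparr>carrier := H\<rparr>)"
    using assms(3) unfolding linear_monoid_def is_iso_def by blast
  have H': "H \<subseteq> carrier_mat n n" "1\<^sub>m n \<in> H"
    using submonoid.subset[OF H] submonoid.one_closed[OF H] by (auto simp: ring_mat_simps)
  have hH: "h ` carrier M = H" and inj: "inj_on h (carrier M)"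
    using h by (auto simp: iso_def bij_betw_def)
  have h_mat: "h m \<in> carrier_mat n n" if "m \<in> carrier M" for m
    using that hH H'(1) by blast
  have h_mult: "h (m \<otimes>\<^bsub>M\<^esub> m') = h m * h m'" if "m \<in> carrier M" "m' \<in> carrier M" for m m'
    using h that by (simp add: iso_def hom_def ring_mat_simps)
  \<comment> \<open>\<open>iso\<close> speaks only of products. The identity is preserved because
    the identity matrix has a preimage \<open>e\<close>, and multiplying by \<open>h e\<close> shows
    that \<open>h \<one>\<close> equals the image of \<open>e\<close>.\<close>
  obtain e where e: "e \<in> carrier M" "h e = 1\<^sub>m n" using hH H'(2) by force
  have h_one: "h \<one>\<^bsub>M\<^esub> = 1\<^sub>m n"
    using h_mult[OF one_closed e(1)] e h_mat[OF one_closed] by simp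
  define E where "E = (\<lambda>(s, i, j). h s $$ (i, j)) ` (S \<times> {..<n} \<times> {..<n})"
  have "finite E" unfolding E_def using S(1) by simp
  then obtain R where R: "unital_subring R" "separated_by_finite_quotients R" "E \<subseteq> R"
    using finite_set_in_separated_subring by blast
  \<comment> \<open>\<open>N\<close> is a submonoid containing the generators, hence all of
    \<open>M\<close>: every matrix has its entries in the one subring \<open>R\<close>.\<close>
  define N where "N = {m \<in> carrier M. \<forall>i<n. \<forall>j<n. h m $$ (i, j) \<in> R}"
  have "submonoid N M"
  proof
    show "N \<subseteq> carrier M" by (auto simp: N_def)
    show "\<one>\<^bsub>M\<^esub> \<in> N" using unital_subringD[OF R(1)] by (simp add: N_def h_one)
    fix m m' assume mm: "m \<in> N" "m' \<in> N"
    then have m: "m \<in> carrier M" "m' \<in> carrier M" by (auto simp: N_def)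
    have "h (m \<otimes>\<^bsub>M\<^esub> m') $$ (i, j) \<in> R" if "i < n" "j < n" for i j
    proof -
      have "h (m \<otimes>\<^bsub>M\<^esub> m') $$ (i, j) = (\<Sum>k\<in>{0..<n}. h m $$ (i, k) * h m' $$ (k, j))"
        using h_mat[OF m(1)] h_mat[OF m(2)] that by (simp add: h_mult[OF m] scalar_prod_def)
      also have "\<dots> \<in> R"
        using mm that by (intro unital_subring_sum unital_subringD(6) R(1)) (auto simp: N_def)
      finally show ?thesis .
    qed
    then show "m \<otimes>\<^bsub>M\<^esub> m' \<in> N" using m by (simp add: N_def)
  qed
  moreover have "S \<subseteq> N"
  proof
    fix s assume s: "s \<in> S"
    have "h s $$ (i, j) \<in> E" if "i < n" "j < n" for i j
      unfolding E_def using s that by (intro image_eqI[of _ _ "(s, i, j)"]) auto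
    then show "s \<in> N" using s S(2) R(3) by (auto simp: N_def)
  qed
  ultimately have "carrier M \<subseteq> N" unfolding S(3)[symmetric] hull_def by blast
  then have hR: "h m $$ (i, j) \<in> R" if "m \<in> carrier M" "i < n" "j < n" for m i j
    using that by (auto simp: N_def)
  show ?thesis
    by (rule surjunctive_if_finite_left_congruences[OF assms(1)])
      (rule finite_left_congruence_matrices[OF assms(1) h_mat h_mult inj R(1,2) hR])
qed

end
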